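(* Let $\mathfrak{g}$ be a commutative Lie algebra over a field $\mathbb{F}$ of characteristic $2$ which has a $1$-dimensional ideal $\mathfrak{h}$. Let $\mathbb{F}_1$ be a $1$-dimensional $\mathfrak{g}$-module on which $\mathfrak{h}$ acts non-trivially, i.e. some generator $x$ of $\mathfrak{h}$ acts by $x\cdot v=v$ for all $v\in\mathbb{F}_1$. Then $$HS^\bullet(\mathfrak{g},\mathbb{F}_1)=0,$$ i.e. $HS^n(\mathfrak{g},\mathbb{F}_1)=0$ for all $n\ge 0$.
   Context: A commutative Lie algebra over a field $\mathbb{F}$ of characteristic $2$ is an $\mathbb{F}$-vector space $\mathfrak{g}$ with a bilinear bracket satisfying $[x,y]=[y,x]$ and $[x,[y,z]]+[y,[z,x]]+[z,[x,y]]=0$ for all $x,y,z$ (it is not required that $[x,x]=0$). A $\mathfrak{g}$-module is an $\mathbb{F}$-vector space $M$ with a bilinear map $\mathfrak{g}\times M\to M$ such that $[x,y]\cdot m=x\cdot(y\cdot m)+y\cdot(x\cdot m)$. Commutative cohomology: $CS^n(\mathfrak{g},M):=\mathrm{Hom}_{\mathbb{F}}(S^n\mathfrak{g},M)$, where $S^n\mathfrak{g}$ is the $n$-th symmetric power (quotient of $\mathfrak{g}^{\otimes n}$), with differential $$d^nf(x_1,\dots,x_{n+1})=\sum_{i=1}^{n+1}x_i\cdot f(x_1,\dots,\hat{x}_i,\dots,x_{n+1})+\sum_{1\le i<j\le n+1}f([x_i,x_j],x_1,\dots,\hat{x}_i,\dots,\hat{x}_j,\dots,x_{n+1}).$$ Its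 cohomology is denoted $HS^\bullet(\mathfrak{g},M)$. *)

theory Defs
  imports
    Complex_Main
    "HOL-Library.Poly_Mapping"
    "HOL-Library.Multiset"
    "HOL-Library.Set_Algebras"
    "HOL-Library.Function_Algebras"
    "HOL-Combinatorics.Permutations"
begin

section \<open>Commutative Lie algebras and their modules\<close>

locale commutative_lie_algebra = vector_space scale
  for scale :: "'f::field \<Rightarrow> 'g::ab_group_add \<Rightarrow> 'g" +
  fixes br :: "'g \<Rightarrow> 'g \<Rightarrow> 'g"
  assumes char_two: "CHAR('f) = 2"
    and br_linear_left: "\<And>y. Vector_Spaces.linear scale scale (\<lambda>x. br x y)"
    and br_linear_right: "\<And>x. Vector_Spaces.linear scale scale (\<lambda>y. br x y)"
    and br_commute: "\<And>x y. br x y = br y x"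
    and jacobi: "\<And>x y z. br x (br y z) + br y (br z x) + br z (br x y) = 0"
begin

text \<open>Left and right ideals coincide because the bracket is commutative.\<close>

definition lie_ideal :: "'g set \<Rightarrow> bool"
  where "lie_ideal h \<longleftrightarrow> subspace h \<and> (\<forall>x. \<forall>y\<in>h. br x y \<in> h)"

end

locale commutative_lie_module =
  commutative_lie_algebra scale br + M: vector_space mscale
  for scale :: "'f::field \<Rightarrow> 'g::ab_group_add \<Rightarrow> 'g"
    and br :: "'g \<Rightarrow> 'g \<Rightarrow> 'g"
    and mscale :: "'f \<Rightarrow> 'm::ab_group_add \<Rightarrow> 'm" +
  fixes act :: "'g \<Rightarrow> 'm \<Rightarrow> 'm"
  assumes act_linear_left: "\<And>m. Vector_Spaces.linear scale mscale (\<lambda>x. act x m)"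
    and act_linear_right: "\<And>x. Vector_Spaces.linear mscale mscale (\<lambda>m. act x m)"
    and act_br: "\<And>x y m. act (br x y) m = act x (act y m) + act y (act x m)"


section \<open>Symmetric powers\<close>

text \<open>
  The quotient \<open>V / W\<close> as a set of cosets; its zero element is \<open>W\<close>.
\<close>

definition cosets :: "'a::ab_group_add set \<Rightarrow> 'a set \<Rightarrow> 'a set set"
  where "cosets V W = (\<lambda>v. v +o W) ` V"

text \<open>
  \<open>free_words n\<close> is the vector space with basis the set of \<open>n\<close>-tuples of elements of
  \<open>'g\<close>, tuples being represented by lists of length \<open>n\<close>.
\<close>

definition fscale :: "'f::field \<Rightarrow> ('k \<Rightarrow>\<^sub>0 'f) \<Rightarrow> ('k \<Rightarrow>\<^sub>0 'f)"
  where "fscale c u = Poly_Mapping.map ((*) c) u"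

lemma lookup_fscale [simp]: "Poly_Mapping.lookup (fscale c u) k = c * Poly_Mapping.lookup u k"
  by (simp add: fscale_def map.rep_eq when_def)

interpretation free: vector_space fscale
  by unfold_locales (auto intro!: poly_mapping_eqI simp: lookup_add algebra_simps)

definition free_words :: "nat \<Rightarrow> ('g list \<Rightarrow>\<^sub>0 'f::field) set"
  where "free_words n = {u. Poly_Mapping.keys u \<subseteq> {xs. length xs = n}}"

abbreviation word :: "'g list \<Rightarrow> ('g list \<Rightarrow>\<^sub>0 'f::field)"
  where "word xs \<equiv> Poly_Mapping.single xs 1"

context commutative_lie_algebra
begin

text \<open>
  Modulo the first two families of relations \<open>free_words n\<close> becomes the tensor power, with
  \<open>word [x\<^sub>1, \<dots>, x\<^sub>n]\<close> becoming \<open>x\<^sub>1 \<otimes> \<dots> \<otimes> x\<^sub>n\<close>; the third family identifies tensors that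
  differ by a permutation of the factors.
\<close>

inductive_set sym_relators :: "nat \<Rightarrow> ('g list \<Rightarrow>\<^sub>0 'f) set" for n
  where
    additive: "Suc (length us + length vs) = n \<Longrightarrow>
      word (us @ (x + y) # vs) - word (us @ x # vs) - word (us @ y # vs) \<in> sym_relators n"
  | homogeneous: "Suc (length us + length vs) = n \<Longrightarrow>
      word (us @ scale c x # vs) - fscale c (word (us @ x # vs)) \<in> sym_relators n"
  | symmetric: "length xs = n \<Longrightarrow> mset ys = mset xs \<Longrightarrow>
      word xs - word ys \<in> sym_relators n"

definition sym_class :: "nat \<Rightarrow> ('g list \<Rightarrow>\<^sub>0 'f) \<Rightarrow> ('g list \<Rightarrow>\<^sub>0 'f) set"
  where "sym_class n u = u +o free.span (sym_relators n)"

definition sym_power :: "nat \<Rightarrow> ('g list \<Rightarrow>\<^sub>0 'f) set set"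
  where "sym_power n = cosets (free_words n) (free.span (sym_relators n))"

text \<open>The product \<open>x\<^sub>1 \<cdots> x\<^sub>n\<close> in the \<open>n\<close>-th symmetric power.\<close>

definition sym_prod :: "'g list \<Rightarrow> ('g list \<Rightarrow>\<^sub>0 'f) set"
  where "sym_prod xs = sym_class (length xs) (word xs)"

end


section \<open>Commutative cohomology\<close>

context commutative_lie_module
begin

text \<open>
  Linear maps from the \<open>n\<close>-th symmetric power to the module. The vector space operations of
  the quotient are those of representatives, which is how linearity is expressed. Cochains
  are set to zero outside the symmetric power, so that equal cochains are equal functions.
\<close>

definition CS :: "nat \<Rightarrow> (('g list \<Rightarrow>\<^sub>0 'f) set \<Rightarrow> 'm) set"
  where "CS n = {f.
    (\<forall>A. A \<notin> sym_power n \<longrightarrow> f A = 0) \<and>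
    (\<forall>u\<in>free_words n. \<forall>v\<in>free_words n.
        f (sym_class n (u + v)) = f (sym_class n u) + f (sym_class n v)) \<and>
    (\<forall>c. \<forall>u\<in>free_words n. f (sym_class n (fscale c u)) = mscale c (f (sym_class n u)))}"

text \<open>
  Here \<open>f (sym_prod [x\<^sub>1, \<dots>, x\<^sub>n])\<close> is what is usually written \<open>f(x\<^sub>1, \<dots>, x\<^sub>n)\<close>, and
  \<open>nths xs (- {i, j})\<close> is the list \<open>xs\<close> with the entries at positions \<open>i\<close> and \<open>j\<close> omitted.
\<close>

definition differential_at :: "(('g list \<Rightarrow>\<^sub>0 'f) set \<Rightarrow> 'm) \<Rightarrow> 'g list \<Rightarrow> 'm"
  where "differential_at f xs =
    (\<Sum>i<length xs. act (xs ! i) (f (sym_prod (nths xs (- {i}))))) +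
    (\<Sum>(i, j) | i < j \<and> j < length xs.
        f (sym_prod (br (xs ! i) (xs ! j) # nths xs (- {i, j}))))"

text \<open>
  The differential is given by its values on products; that this determines a unique linear
  map on the symmetric power is the lemma \<open>differential_ex1\<close> below.
\<close>

definition differential ::
    "nat \<Rightarrow> (('g list \<Rightarrow>\<^sub>0 'f) set \<Rightarrow> 'm) \<Rightarrow> (('g list \<Rightarrow>\<^sub>0 'f) set \<Rightarrow> 'm)"
  where "differential n f = (THE g. g \<in> CS (Suc n) \<and>
    (\<forall>xs. length xs = Suc n \<longrightarrow> g (sym_prod xs) = differential_at f xs))"

definition cocycles :: "nat \<Rightarrow> (('g list \<Rightarrow>\<^sub>0 'f) set \<Rightarrow> 'm) set"
  where "cocycles n = {f \<in> CS n. differential n f = 0}"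

fun coboundaries :: "nat \<Rightarrow> (('g list \<Rightarrow>\<^sub>0 'f) set \<Rightarrow> 'm) set"
  where
    "coboundaries 0 = {0}"
  | "coboundaries (Suc n) = differential n ` CS n"

text \<open>The zero element of \<open>HS n\<close> is the coset \<open>coboundaries n\<close>.\<close>

definition HS :: "nat \<Rightarrow> (('g list \<Rightarrow>\<^sub>0 'f) set \<Rightarrow> 'm) set set"
  where "HS n = cosets (cocycles n) (coboundaries n)"


text \<open>
  Linear maps on the symmetric power correspond to symmetric multilinear maps, and
  \<^term>\<open>differential_at f\<close> is one of these.
\<close>

definition sym_multilinear :: "nat \<Rightarrow> ('g list \<Rightarrow> 'm) \<Rightarrow> bool"
  where "sym_multilinear n p \<longleftrightarrow>
    (\<forall>us vs x y. Suc (length us + length vs) = n \<longrightarrow>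
        p (us @ (x + y) # vs) = p (us @ x # vs) + p (us @ y # vs)) \<and>
    (\<forall>us vs c x. Suc (length us + length vs) = n \<longrightarrow>
        p (us @ scale c x # vs) = mscale c (p (us @ x # vs))) \<and>
    (\<forall>xs ys. length xs = n \<longrightarrow> mset ys = mset xs \<longrightarrow> p xs = p ys)"

lemma free_subspace: "free.subspace (free_words n :: ('g list \<Rightarrow>\<^sub>0 'f) set)"
proof (rule free.subspaceI)
  show "0 \<in> (free_words n :: ('g list \<Rightarrow>\<^sub>0 'f) set)" by (simp add: free_words_def)
next
  fix u v :: "'g list \<Rightarrow>\<^sub>0 'f" assume "u \<in> free_words n" "v \<in> free_words n"
  then show "u + v \<in> free_words n"
    using Poly_Mapping.keys_add[of u v] by (auto simp: free_words_def)
next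
  fix c and u :: "'g list \<Rightarrow>\<^sub>0 'f" assume "u \<in> free_words n"
  then show "fscale c u \<in> free_words n"
    by (auto simp: free_words_def in_keys_iff)
qed

lemma word_in_free_words: "length xs = n \<Longrightarrow> word xs \<in> free_words n"
  by (simp add: free_words_def)

lemma sym_class_eq_iff:
  "sym_class n u = sym_class n v \<longleftrightarrow> u - v \<in> free.span (sym_relators n)"
proof
  assume "sym_class n u = sym_class n v"
  moreover have "u \<in> sym_class n u"
    unfolding sym_class_def elt_set_plus_def
    by (rule CollectI, rule bexI[of _ 0]) (simp_all add: free.span_zero)
  ultimately have "u \<in> sym_class n v" by simp
  then show "u - v \<in> free.span (sym_relators n)"
    by (auto simp: sym_class_def elt_set_plus_def)
next
  assume *: "u - v \<in> free.span (sym_relators n)"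
  have 1: "u + b \<in> sym_class n v" if "b \<in> free.span (sym_relators n)" for b
    unfolding sym_class_def elt_set_plus_def
    by (rule CollectI, rule bexI[of _ "(u - v) + b"]) (use that * in \<open>auto intro: free.span_add\<close>)
  have 2: "v + b \<in> sym_class n u" if "b \<in> free.span (sym_relators n)" for b
    unfolding sym_class_def elt_set_plus_def
    by (rule CollectI, rule bexI[of _ "b - (u - v)"]) (use that * in \<open>auto intro: free.span_diff\<close>)
  from 1 2 show "sym_class n u = sym_class n v"
    by (auto simp: sym_class_def elt_set_plus_def)
qed

lemma sym_power_eq: "sym_power n = sym_class n ` free_words n"
  by (simp add: sym_power_def cosets_def sym_class_def)

definition word_extend :: "('g list \<Rightarrow> 'm) \<Rightarrow> ('g list \<Rightarrow>\<^sub>0 'f) \<Rightarrow> 'm"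
  where "word_extend p u = (\<Sum>xs\<in>Poly_Mapping.keys u. mscale (Poly_Mapping.lookup u xs) (p xs))"

lemma word_extend_superset:
  assumes "finite X" "Poly_Mapping.keys u \<subseteq> X"
  shows "word_extend p u = (\<Sum>xs\<in>X. mscale (Poly_Mapping.lookup u xs) (p xs))"
  unfolding word_extend_def
  by (rule sum.mono_neutral_left) (use assms in \<open>auto simp: in_keys_iff\<close>)

lemma word_extend_add: "word_extend p (u + v) = word_extend p u + word_extend p v"
proof -
  let ?X = "Poly_Mapping.keys u \<union> Poly_Mapping.keys v"
  have "word_extend p (u + v) = (\<Sum>xs\<in>?X. mscale (Poly_Mapping.lookup (u + v) xs) (p xs))"
    by (rule word_extend_superset) (use Poly_Mapping.keys_add[of u v] in auto)
  also have "\<dots> = (\<Sum>xs\<in>?X. mscale (Poly_Mapping.lookup u xs) (p xs)) +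
      (\<Sum>xs\<in>?X. mscale (Poly_Mapping.lookup v xs) (p xs))"
    by (simp add: lookup_add M.scale_left_distrib sum.distrib)
  also have "\<dots> = word_extend p u + word_extend p v"
    by (subst (1 2) word_extend_superset[where X = ?X]) auto
  finally show ?thesis .
qed

lemma word_extend_fscale: "word_extend p (fscale c u) = mscale c (word_extend p u)"
proof -
  have "word_extend p (fscale c u) =
      (\<Sum>xs\<in>Poly_Mapping.keys u. mscale (Poly_Mapping.lookup (fscale c u) xs) (p xs))"
    by (rule word_extend_superset) (auto simp: in_keys_iff)
  then show ?thesis
    by (simp add: word_extend_def M.scale_sum_right)
qed

lemma word_extend_word [simp]: "word_extend p (word xs) = p xs"
  by (simp add: word_extend_def)

lemma word_extend_uminus: "word_extend p (- u) = - word_extend p u"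
  by (metis add_eq_0_iff ab_left_minus add.right_inverse add_cancel_right_right word_extend_add)

lemma word_extend_diff: "word_extend p (u - v) = word_extend p u - word_extend p v"
  using word_extend_add[of p u "- v"] by (simp add: word_extend_uminus)

lemma word_extend_span:
  assumes "sym_multilinear n p" "u \<in> free.span (sym_relators n)"
  shows "word_extend p u = 0"
  using assms(2)
proof (induction rule: free.span_induct_alt)
  case base
  then show ?case by (simp add: word_extend_def)
next
  case (step c r u)
  have "word_extend p r = 0"
    using step(1)
  proof cases
    case (additive us vs x y)
    then show ?thesis using assms(1)
      by (simp add: word_extend_diff sym_multilinear_def)
  next
    case (homogeneous us vs c x)
    then show ?thesis using assms(1)
      by (simp add: word_extend_diff word_extend_fscale sym_multilinear_def)
  next
    case (symmetric xs ys)
    then have "p xs = p ys" using assms(1) unfolding sym_multilinear_def by blast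
    then show ?thesis using symmetric by (simp add: word_extend_diff)
  qed
  then show ?case using step by (simp add: word_extend_add word_extend_fscale)
qed

lemma free_words_induct [consumes 1, case_names zero add]:
  assumes "u \<in> free_words n" "P 0"
    and "\<And>c xs v. length xs = n \<Longrightarrow> v \<in> free_words n \<Longrightarrow> P v \<Longrightarrow> P (fscale c (word xs) + v)"
  shows "P (u :: 'g list \<Rightarrow>\<^sub>0 'f)"
proof -
  have "P u" if "finite X" "Poly_Mapping.keys u \<subseteq> X" "X \<subseteq> {xs. length xs = n}"
    for X and u :: "'g list \<Rightarrow>\<^sub>0 'f"
    using that
  proof (induction X arbitrary: u rule: finite_induct)
    case empty
    then have "u = 0" by (metis keys_eq_empty subset_empty)
    then show ?case using assms(2) by simp
  next
    case (insert xs X)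
    let ?c = "Poly_Mapping.lookup u xs"
    let ?v = "u - fscale ?c (word xs)"
    have k: "Poly_Mapping.keys ?v \<subseteq> X"
    proof
      fix ys assume "ys \<in> Poly_Mapping.keys ?v"
      then have "Poly_Mapping.lookup u ys - ?c * Poly_Mapping.lookup (word xs) ys \<noteq> 0"
        by (simp add: in_keys_iff lookup_minus)
      then have "ys \<noteq> xs" "Poly_Mapping.lookup u ys \<noteq> 0"
        by (auto simp: lookup_single when_def split: if_splits)
      then show "ys \<in> X" using insert by (auto simp: in_keys_iff)
    qed
    then have "P ?v" using insert by auto
    moreover have "?v \<in> free_words n" using k insert unfolding free_words_def by auto
    ultimately have "P (fscale ?c (word xs) + ?v)" using insert by (intro assms(3)) auto
    then show ?case by simp
  qed
  from this[of "Poly_Mapping.keys u" u] show ?thesis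
    using assms(1) by (simp add: free_words_def)
qed

lemma CS_eqI:
  assumes "f \<in> CS n" "g \<in> CS n" "\<And>xs. length xs = n \<Longrightarrow> f (sym_prod xs) = g (sym_prod xs)"
  shows "f = g"
proof
  fix A
  show "f A = g A"
  proof (cases "A \<in> sym_power n")
    case False
    then show ?thesis using assms by (simp add: CS_def)
  next
    case True
    then obtain u where u: "u \<in> free_words n" "A = sym_class n u" by (auto simp: sym_power_eq)
    have "f (sym_class n u) = g (sym_class n u)" using u(1)
    proof (induction rule: free_words_induct)
      case zero
      have z: "k (sym_class n 0) = 0" if "k \<in> CS n" for k
      proof -
        have "k (sym_class n (fscale 0 0)) = mscale 0 (k (sym_class n 0))"
          using that free.subspace_0[OF free_subspace] unfolding CS_def by blast
        then show ?thesis by simp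
      qed
      from z[OF assms(1)] z[OF assms(2)] show ?case by simp
    next
      case (add c xs v)
      have w: "(word xs :: 'g list \<Rightarrow>\<^sub>0 'f) \<in> free_words n" using add by (simp add: word_in_free_words)
      have e: "k (sym_class n (fscale c (word xs) + v)) =
          mscale c (k (sym_prod xs)) + k (sym_class n v)" if "k \<in> CS n" for k
        using that w add free.subspace_scale[OF free_subspace w]
        by (simp add: CS_def sym_prod_def)
      show ?case using e[OF assms(1)] e[OF assms(2)] add assms(3) by simp
    qed
    then show ?thesis using u by simp
  qed
qed

lemma CS_ex1:
  assumes "sym_multilinear n p"
  shows "\<exists>!g. g \<in> CS n \<and> (\<forall>xs. length xs = n \<longrightarrow> g (sym_prod xs) = p xs)"
proof (rule ex_ex1I)
  define g where "g A = (if A \<in> sym_power n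
    then word_extend p (SOME u. u \<in> free_words n \<and> A = sym_class n u) else 0)" for A
  have g: "g (sym_class n u) = word_extend p u" if u: "u \<in> free_words n" for u
  proof -
    let ?v = "SOME v. v \<in> free_words n \<and> sym_class n u = sym_class n v"
    have "sym_class n u = sym_class n ?v"
      using someI[of "\<lambda>v. v \<in> free_words n \<and> sym_class n u = sym_class n v" u] u by auto
    then have "word_extend p (u - ?v) = 0"
      using assms by (simp add: sym_class_eq_iff word_extend_span)
    then show ?thesis using u by (simp add: g_def sym_power_eq word_extend_diff)
  qed
  show "\<exists>g. g \<in> CS n \<and> (\<forall>xs. length xs = n \<longrightarrow> g (sym_prod xs) = p xs)"
  proof (intro exI conjI allI impI)
    show "g \<in> CS n"
      unfolding CS_def
      by (auto simp: g word_extend_add word_extend_fscale free.subspace_add[OF free_subspace]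
          free.subspace_scale[OF free_subspace]) (simp add: g_def)
    show "g (sym_prod xs) = p xs" if "length xs = n" for xs
      using that by (simp add: sym_prod_def g word_in_free_words)
  qed
qed (auto intro: CS_eqI)

lemma CS_sym_multilinear:
  assumes f: "f \<in> CS n"
  shows "sym_multilinear n (\<lambda>xs. f (sym_prod xs))"
  unfolding sym_multilinear_def
proof (intro conjI allI impI)
  fix us vs :: "'g list" and x y
  assume n: "Suc (length us + length vs) = n"
  have "sym_class n (word (us @ (x + y) # vs)) =
      sym_class n (word (us @ x # vs) + word (us @ y # vs))"
    unfolding sym_class_eq_iff
    using free.span_base[OF sym_relators.additive[OF n, of x y]] by (simp add: algebra_simps)
  then show "f (sym_prod (us @ (x + y) # vs)) =
      f (sym_prod (us @ x # vs)) + f (sym_prod (us @ y # vs))"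
    using f n by (simp add: sym_prod_def CS_def word_in_free_words)
next
  fix us vs :: "'g list" and c x
  assume n: "Suc (length us + length vs) = n"
  have "sym_class n (word (us @ scale c x # vs)) = sym_class n (fscale c (word (us @ x # vs)))"
    unfolding sym_class_eq_iff
    using free.span_base[OF sym_relators.homogeneous[OF n, of c x]] .
  then show "f (sym_prod (us @ scale c x # vs)) = mscale c (f (sym_prod (us @ x # vs)))"
    using f n by (simp add: sym_prod_def CS_def word_in_free_words)
next
  fix xs ys :: "'g list"
  assume n: "length xs = n" "mset ys = mset xs"
  have "sym_class n (word xs) = sym_class n (word ys)"
    unfolding sym_class_eq_iff using free.span_base[OF sym_relators.symmetric[OF n]] .
  then show "f (sym_prod xs) = f (sym_prod ys)"
    using n by (simp add: sym_prod_def mset_eq_length[OF n(2)])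
qed

lemma sym_multilinearI:
  assumes add: "\<And>vs x y. Suc (length vs) = n \<Longrightarrow> p ((x + y) # vs) = p (x # vs) + p (y # vs)"
    and scale: "\<And>vs c x. Suc (length vs) = n \<Longrightarrow> p (scale c x # vs) = mscale c (p (x # vs))"
    and sym: "\<And>xs ys. length xs = n \<Longrightarrow> mset ys = mset xs \<Longrightarrow> p xs = p ys"
  shows "sym_multilinear n p"
proof -
  have *: "p (us @ x # vs) = p (x # us @ vs)" if "Suc (length us + length vs) = n" for us vs x
    by (rule sym) (use that in auto)
  show ?thesis
    unfolding sym_multilinear_def by (auto simp: * add scale intro: sym)
qed

lemma mset_nths: "mset (nths xs I) = image_mset ((!) xs) (mset_set {i. i < length xs \<and> i \<in> I})"
proof -
  have "mset (nths xs I) = image_mset fst (filter_mset (\<lambda>p. snd p \<in> I) (mset (zip xs [0..<length xs])))"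
    by (simp add: nths_def)
  also have "zip xs [0..<length xs] = map (\<lambda>i. (xs ! i, i)) [0..<length xs]"
    by (rule nth_equalityI) auto
  finally show ?thesis
    by (simp add: image_mset.compositionality filter_mset_image_mset comp_def
        filter_mset_mset_set del: mset_upt flip: mset_upt)
       (auto simp: atLeast0LessThan lessThan_def intro!: arg_cong2[where f = image_mset] arg_cong[where f = mset_set])
qed

lemma mset_nths_Compl:
  assumes "I \<subseteq> {..<length xs}"
  shows "mset (nths xs (- I)) = mset xs - image_mset ((!) xs) (mset_set I)"
proof -
  have "{i. i < length xs \<and> i \<in> - I} = {..<length xs} - I" by auto
  moreover have "mset xs = image_mset ((!) xs) (mset_set {..<length xs})"
    using mset_nths[of xs UNIV] by (simp add: nths_all lessThan_def)
  moreover have "finite I" using assms finite_subset by blast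
  ultimately show ?thesis
    using assms
    by (simp add: mset_nths mset_set_Diff image_mset_Diff subset_imp_msubset_mset_set)
qed

lemma length_nths_Compl:
  assumes "I \<subseteq> {..<length xs}"
  shows "length (nths xs (- I)) = length xs - card I"
proof -
  have "{i. i < length xs \<and> i \<in> - I} = {..<length xs} - I" by auto
  then show ?thesis using assms
    by (simp add: length_nths card_Diff_subset finite_subset[OF assms])
qed

lemma mset_nths_Compl_permute:
  assumes "\<pi> permutes {..<length xs}" "I \<subseteq> {..<length xs}"
  shows "mset (nths (permute_list \<pi> xs) (- I)) = mset (nths xs (- (\<pi> ` I)))"
proof -
  have I': "\<pi> ` I \<subseteq> {..<length xs}"
    using assms permutes_image by blast
  have "image_mset ((!) (permute_list \<pi> xs)) (mset_set I) =
      image_mset ((!) xs) (image_mset \<pi> (mset_set I))"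
    unfolding image_mset.compositionality comp_def
    using assms by (intro image_mset_cong) (auto simp: permute_list_nth finite_subset[OF assms(2)])
  also have "image_mset \<pi> (mset_set I) = mset_set (\<pi> ` I)"
    using permutes_inj_on[OF assms(1)] by (rule image_mset_mset_set)
  finally show ?thesis
    using assms I' by (simp add: mset_nths_Compl)
qed

lemma sum_pairs_permute:
  fixes K :: "nat \<Rightarrow> nat \<Rightarrow> 'm"
  assumes \<pi>: "\<pi> permutes {..<n}" and K: "\<And>i j. K i j = K j i"
  shows "(\<Sum>(i, j) | i < j \<and> j < n. K (\<pi> i) (\<pi> j)) = (\<Sum>(i, j) | i < j \<and> j < n. K i j)"
proof -
  define s where "s \<sigma> = (\<lambda>(i :: nat, j :: nat). (min (\<sigma> i) (\<sigma> j), max (\<sigma> i) (\<sigma> j) :: nat))" for \<sigma>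
  have lt: "\<sigma> i < n" if "\<sigma> permutes {..<n}" "i < n" for \<sigma> i
    using that permutes_in_image by fastforce
  have ne: "\<sigma> i \<noteq> \<sigma> j" if "\<sigma> permutes {..<n}" "i < j" for \<sigma> and i j :: nat
    using permutes_inj[OF that(1)] that(2) by (auto dest: injD)
  have in_s: "s \<sigma> a \<in> {(i, j). i < j \<and> j < n}"
    if "\<sigma> permutes {..<n}" "a \<in> {(i, j). i < j \<and> j < n}" for \<sigma> a
    using that lt[OF that(1)] ne[OF that(1), of "fst a" "snd a"]
    by (cases a) (auto simp: s_def min_def max_def)
  have inv: "s \<sigma> (s \<tau> a) = a"
    if "\<sigma> \<circ> \<tau> = id" "a \<in> {(i, j). i < j \<and> j < n}" for \<sigma> \<tau> a
    using that by (cases a) (auto simp: s_def min_def max_def fun_eq_iff)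
  note \<pi>' = permutes_inv[OF \<pi>]
  show ?thesis
  proof (rule sum.reindex_bij_witness[where j = "s \<pi>" and i = "s (inv \<pi>)"])
    fix a assume a: "a \<in> {(i, j). i < j \<and> j < n}"
    show "s (inv \<pi>) (s \<pi> a) = a" using inv[OF permutes_inv_o(2)[OF \<pi>] a] .
    show "s \<pi> (s (inv \<pi>) a) = a" using inv[OF permutes_inv_o(1)[OF \<pi>] a] .
    show "s \<pi> a \<in> {(i, j). i < j \<and> j < n}" by (rule in_s[OF \<pi> a])
    show "s (inv \<pi>) a \<in> {(i, j). i < j \<and> j < n}" by (rule in_s[OF \<pi>' a])
    show "(case s \<pi> a of (i, j) \<Rightarrow> K i j) = (case a of (i, j) \<Rightarrow> K (\<pi> i) (\<pi> j))"
      by (cases a) (auto simp: s_def min_def max_def K)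
  qed
qed

lemma differential_at_sym_multilinear:
  assumes f: "f \<in> CS n"
  shows "sym_multilinear (Suc n) (differential_at f)"
proof (rule sym_multilinearI)
  define F where "F xs = f (sym_prod xs)" for xs
  have F: "sym_multilinear n F"
    using CS_sym_multilinear[OF f] by (simp add: F_def[abs_def])
  have F_sym: "F xs = F ys" if "length xs = n" "mset ys = mset xs" for xs ys
    using F that unfolding sym_multilinear_def by blast
  have F_add: "F (us @ (x + y) # vs) = F (us @ x # vs) + F (us @ y # vs)"
    if "Suc (length us + length vs) = n" for us vs x y
    using F that unfolding sym_multilinear_def by blast
  have F_scale: "F (us @ scale c x # vs) = mscale c (F (us @ x # vs))"
    if "Suc (length us + length vs) = n" for us vs c x
    using F that unfolding sym_multilinear_def by blast
  note F_add0 = F_add[of "[]", simplified] and F_add1 = F_add[of "[a]" for a, simplified]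
  note F_scale0 = F_scale[of "[]", simplified] and F_scale1 = F_scale[of "[a]" for a, simplified]
  have D: "differential_at f xs = (\<Sum>i<length xs. act (xs ! i) (F (nths xs (- {i})))) +
      (\<Sum>(i, j) | i < j \<and> j < length xs. F (br (xs ! i) (xs ! j) # nths xs (- {i, j})))" for xs
    by (simp add: differential_at_def F_def)
  have fin: "finite {(i, j). i < j \<and> j < (k :: nat)}" for k
    by (rule finite_subset[of _ "{..<k} \<times> {..<k}"]) auto
  have nC0: "nths (x # vs) (- {0}) = vs" for x :: 'g and vs
    by (simp add: nths_Cons nths_all)
  have nC1: "nths (x # vs) (- {Suc i}) = x # nths vs (- {i})" for x :: 'g and vs i
    by (simp add: nths_Cons Compl_eq)
  have nC2: "nths (x # vs) (- {0, Suc j}) = nths vs (- {j})" for x :: 'g and vs j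
    by (simp add: nths_Cons Compl_eq)
  have nC3: "nths (x # vs) (- {Suc i, Suc j}) = x # nths vs (- {i, j})" for x :: 'g and vs i j
    by (simp add: nths_Cons Compl_eq)
  have len1: "Suc (length (nths vs (- {i}))) = n" if "length vs = n" "i < n" for vs :: "'g list" and i
    using that by (simp add: length_nths_Compl)
  have len2: "Suc (Suc (length (nths vs (- {i, j})))) = n"
    if "length vs = n" "i < j" "j < n" for vs :: "'g list" and i j
    using that by (simp add: length_nths_Compl)
  note lin = br_linear_left[THEN Vector_Spaces.linear.axioms(3)]
    act_linear_left[THEN Vector_Spaces.linear.axioms(3)]
    act_linear_right[THEN Vector_Spaces.linear.axioms(3)]
  note lin_simps = lin[THEN module_hom.add] lin[THEN module_hom.scale]
  show "differential_at f ((x + y) # vs) = differential_at f (x # vs) + differential_at f (y # vs)"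
    if "Suc (length vs) = Suc n" for vs x y
  proof -
    have v: "length vs = n" using that by simp
    have 1: "act (((x + y) # vs) ! i) (F (nths ((x + y) # vs) (- {i}))) =
        act ((x # vs) ! i) (F (nths (x # vs) (- {i}))) +
        act ((y # vs) ! i) (F (nths (y # vs) (- {i})))" if "i < Suc n" for i
      using that v len1[OF v]
      by (cases i) (simp_all add: nC0 nC1 lin_simps F_add0)
    have 2: "F (br (((x + y) # vs) ! i) (((x + y) # vs) ! j) # nths ((x + y) # vs) (- {i, j})) =
        F (br ((x # vs) ! i) ((x # vs) ! j) # nths (x # vs) (- {i, j})) +
        F (br ((y # vs) ! i) ((y # vs) ! j) # nths (y # vs) (- {i, j}))"
      if "i < j" "j < Suc n" for i j
      using that v len1[OF v] len2[OF v]
      by (cases i; cases j) (simp_all add: nC2 nC3 lin_simps F_add0 F_add1)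
    show ?thesis
      unfolding D using 1 2 v
      by (simp add: sum.distrib case_prod_unfold add.assoc add.left_commute)
  qed
  show "differential_at f (scale c x # vs) = mscale c (differential_at f (x # vs))"
    if "Suc (length vs) = Suc n" for vs c x
  proof -
    have v: "length vs = n" using that by simp
    have 1: "act ((scale c x # vs) ! i) (F (nths (scale c x # vs) (- {i}))) =
        mscale c (act ((x # vs) ! i) (F (nths (x # vs) (- {i}))))" if "i < Suc n" for i
      using that v len1[OF v]
      by (cases i) (simp_all add: nC0 nC1 lin_simps F_scale0)
    have 2: "F (br ((scale c x # vs) ! i) ((scale c x # vs) ! j) # nths (scale c x # vs) (- {i, j})) =
        mscale c (F (br ((x # vs) ! i) ((x # vs) ! j) # nths (x # vs) (- {i, j})))"
      if "i < j" "j < Suc n" for i j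
      using that v len1[OF v] len2[OF v]
      by (cases i; cases j) (simp_all add: nC2 nC3 lin_simps F_scale0 F_scale1)
    show ?thesis
      unfolding D using 1 2 v
      by (simp add: M.scale_right_distrib M.scale_sum_right case_prod_unfold)
  qed
  show "differential_at f xs = differential_at f ys"
    if "length xs = Suc n" "mset ys = mset xs" for xs ys
  proof -
    obtain \<pi> where \<pi>: "\<pi> permutes {..<length xs}" and ys: "ys = permute_list \<pi> xs"
      using mset_eq_permutation[OF \<open>mset ys = mset xs\<close>] by metis
    have \<pi>_lt: "\<pi> i < length xs" if "i < length xs" for i
      using that \<pi> permutes_in_image by fastforce
    have \<pi>_ne: "\<pi> i \<noteq> \<pi> j" if "i \<noteq> j" for i j
      using permutes_inj[OF \<pi>] that by (auto dest: injD)
    have len: "length ys = length xs" by (simp add: ys)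
    have 1: "act (ys ! i) (F (nths ys (- {i}))) = act (xs ! \<pi> i) (F (nths xs (- {\<pi> i})))"
      if i: "i < length xs" for i
    proof -
      have "F (nths ys (- {i})) = F (nths xs (- {\<pi> i}))"
        using i len \<open>length xs = Suc n\<close> mset_nths_Compl_permute[OF \<pi>, of "{i}"]
        by (intro F_sym) (simp_all add: length_nths_Compl ys)
      then show ?thesis using i \<pi> by (simp add: ys permute_list_nth)
    qed
    have 2: "F (br (ys ! i) (ys ! j) # nths ys (- {i, j})) =
        F (br (xs ! \<pi> i) (xs ! \<pi> j) # nths xs (- {\<pi> i, \<pi> j}))"
      if ij: "i < j" "j < length xs" for i j
    proof -
      have i: "i < length xs" using ij by simp
      have "length (nths ys (- {i, j})) = length ys - card {i, j}"
        by (rule length_nths_Compl) (use ij len in auto)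
      then have l: "Suc (length (nths ys (- {i, j}))) = n"
        using ij len \<open>length xs = Suc n\<close> by simp
      have m: "mset (nths ys (- {i, j})) = mset (nths xs (- {\<pi> i, \<pi> j}))"
        using mset_nths_Compl_permute[OF \<pi>, of "{i, j}"] ij by (simp add: ys)
      have b: "br (ys ! i) (ys ! j) = br (xs ! \<pi> i) (xs ! \<pi> j)"
        using i ij \<pi> by (simp add: ys permute_list_nth)
      show ?thesis unfolding b by (rule F_sym) (use l m in simp_all)
    qed
    have "(\<Sum>i<length xs. act (ys ! i) (F (nths ys (- {i})))) =
        (\<Sum>i<length xs. act (xs ! \<pi> i) (F (nths xs (- {\<pi> i}))))"
      using 1 by simp
    also have "\<dots> = (\<Sum>i<length xs. act (xs ! i) (F (nths xs (- {i}))))"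
      using sum.permute[OF \<pi>, of "\<lambda>i. act (xs ! i) (F (nths xs (- {i})))"] by (simp add: comp_def)
    finally have A: "(\<Sum>i<length xs. act (ys ! i) (F (nths ys (- {i})))) =
        (\<Sum>i<length xs. act (xs ! i) (F (nths xs (- {i}))))" .
    have "(\<Sum>(i, j) | i < j \<and> j < length xs. F (br (ys ! i) (ys ! j) # nths ys (- {i, j}))) =
        (\<Sum>(i, j) | i < j \<and> j < length xs. F (br (xs ! \<pi> i) (xs ! \<pi> j) # nths xs (- {\<pi> i, \<pi> j})))"
      by (rule sum.cong) (auto simp: 2)
    also have "\<dots> = (\<Sum>(i, j) | i < j \<and> j < length xs. F (br (xs ! i) (xs ! j) # nths xs (- {i, j})))"
      by (rule sum_pairs_permute[OF \<pi>]) (simp add: br_commute insert_commute)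
    finally show ?thesis using A by (simp add: D len)
  qed
qed

lemma differential_ex1:
  assumes "f \<in> CS n"
  shows "\<exists>!g. g \<in> CS (Suc n) \<and>
    (\<forall>xs. length xs = Suc n \<longrightarrow> g (sym_prod xs) = differential_at f xs)"
  by (rule CS_ex1[OF differential_at_sym_multilinear[OF assms]])

lemma differential_in_CS: "f \<in> CS n \<Longrightarrow> differential n f \<in> CS (Suc n)"
  and differential_sym_prod:
    "f \<in> CS n \<Longrightarrow> length xs = Suc n \<Longrightarrow> differential n f (sym_prod xs) = differential_at f xs"
  using theI'[OF differential_ex1, of f n] by (auto simp: differential_def)

end

end

theory Submission
  imports Defs
begin

text \<open>
  Contraction with \<open>x\<close>, the operator \<open>(\<iota>\<^sub>x f)(x\<^sub>1, \<dots>, x\<^sub>n) = f(x, x\<^sub>1, \<dots>, x\<^sub>n)\<close>, makes sense for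
  symmetric cochains just as it does for alternating ones, and Cartan's formula
  \<open>d \<iota>\<^sub>x + \<iota>\<^sub>x d = L\<^sub>x\<close> holds for it: expanding \<open>df(x, x\<^sub>1, \<dots>, x\<^sub>n)\<close>, the terms in which \<open>x\<close>
  remains an untouched argument are exactly those of \<open>d(\<iota>\<^sub>x f)(x\<^sub>1, \<dots>, x\<^sub>n)\<close>, so they cancel in
  characteristic \<open>2\<close>, and what remains is the Lie derivative
  \<open>(L\<^sub>x f)(x\<^sub>1, \<dots>, x\<^sub>n) = x \<cdot> f(x\<^sub>1, \<dots>, x\<^sub>n) + \<Sum>\<^sub>i f([x, x\<^sub>i], x\<^sub>1, \<dots>, x\<^sub>n)\<close>, with \<open>x\<^sub>i\<close> left out in
  the \<open>i\<close>-th summand.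

  Let \<open>x\<close> be the generator of the ideal. Since \<open>x\<close> acts as the identity, its action commutes
  with that of every \<open>y\<close>, so \<open>[x, y]\<close> acts as zero. But \<open>[x, y] = c x\<close> acts as the scalar \<open>c\<close>;
  hence \<open>c\<close> kills the module, and with it every value \<open>f([x, y], \<dots>) = c f(x, \<dots>)\<close>. Therefore
  \<open>L\<^sub>x\<close> is the identity, \<open>\<iota>\<^sub>x\<close> is a contracting homotopy, and a cocycle \<open>f\<close> equals \<open>d(\<iota>\<^sub>x f)\<close>.
  In degree \<open>0\<close> there is no \<open>\<iota>\<^sub>x f\<close>, and the formula reads \<open>df(x) = x \<cdot> f = f\<close>.
\<close>

lemma cosets_eq_singleton:
  fixes V W :: "'a::ab_group_add set"
  assumes "0 \<in> V" "V \<subseteq> W"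
    and add: "\<And>v w. v \<in> W \<Longrightarrow> w \<in> W \<Longrightarrow> v + w \<in> W"
    and uminus: "\<And>v. v \<in> W \<Longrightarrow> - v \<in> W"
  shows "cosets V W = {W}"
proof -
  have "v +o W = W" if "v \<in> W" for v
  proof
    show "v +o W \<subseteq> W" using add that by (auto simp: elt_set_plus_def)
    show "W \<subseteq> v +o W"
    proof
      fix w assume "w \<in> W"
      then have "- v + w \<in> W" using add uminus that by blast
      then show "w \<in> v +o W" by (auto simp: elt_set_plus_def intro!: bexI[of _ "- v + w"])
    qed
  qed
  then show ?thesis using assms(1,2) by (auto simp: cosets_def)
qed

context commutative_lie_module
begin

lemma double_zero: "m + m = (0 :: 'm)"
proof -
  have "(1 :: 'f) + 1 = of_nat CHAR('f)" unfolding char_two by simp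
  then have "(1 :: 'f) + 1 = 0" by simp
  moreover have "m + m = mscale (1 + 1) m" by (simp only: M.scale_left_distrib M.scale_one)
  ultimately show ?thesis by simp
qed

lemma uminus_self: "- m = (m :: 'm)"
  using double_zero[of m] by (simp add: minus_unique)

lemma act_add: "act x (m + m') = act x m + act x m'"
  using act_linear_right[THEN Vector_Spaces.linear.axioms(3), THEN module_hom.add] .

lemma act_scale: "act (scale c x) m = mscale c (act x m)"
  using act_linear_left[THEN Vector_Spaces.linear.axioms(3), THEN module_hom.scale] .

lemma act_zero: "act x 0 = 0"
  using act_add[of x 0 0] by simp


section \<open>Coboundaries form a subgroup\<close>

lemma zero_in_CS: "0 \<in> CS n"
  by (simp add: CS_def)

lemma add_in_CS: "f \<in> CS n \<Longrightarrow> g \<in> CS n \<Longrightarrow> f + g \<in> CS n"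
  by (simp add: CS_def M.scale_right_distrib add_ac)

lemma differential_at_add: "differential_at (f + g) xs = differential_at f xs + differential_at g xs"
  by (simp add: differential_at_def act_add sum.distrib case_prod_unfold add_ac)

lemma differential_at_zero: "differential_at 0 xs = 0"
  by (simp add: differential_at_def act_zero)

lemma differential_eqI:
  assumes "f \<in> CS n" "g \<in> CS (Suc n)"
    and "\<And>xs. length xs = Suc n \<Longrightarrow> g (sym_prod xs) = differential_at f xs"
  shows "differential n f = g"
  using assms by (intro CS_eqI[OF differential_in_CS]) (simp_all add: differential_sym_prod)

lemma differential_zero: "differential n 0 = 0"
  by (rule differential_eqI) (simp_all add: zero_in_CS differential_at_zero)

lemma differential_add:
  assumes "f \<in> CS n" "g \<in> CS n"
  shows "differential n (f + g) = differential n f + differential n g"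
  using assms
  by (intro differential_eqI)
    (simp_all add: add_in_CS differential_in_CS differential_sym_prod differential_at_add)

lemma zero_in_cocycles: "0 \<in> cocycles n"
  by (simp add: cocycles_def zero_in_CS differential_zero)

lemma coboundaries_add:
  assumes "f \<in> coboundaries n" "g \<in> coboundaries n"
  shows "f + g \<in> coboundaries n"
proof (cases n)
  case 0
  then show ?thesis using assms by simp
next
  case (Suc m)
  then obtain f' g' where "f' \<in> CS m" "f = differential m f'" "g' \<in> CS m" "g = differential m g'"
    using assms by auto
  then show ?thesis using Suc by (auto simp: add_in_CS simp flip: differential_add)
qed

lemma coboundaries_uminus: "f \<in> coboundaries n \<Longrightarrow> - f \<in> coboundaries n"
proof -
  have "- f = f" by (simp add: fun_eq_iff uminus_self)
  then show "f \<in> coboundaries n \<Longrightarrow> - f \<in> coboundaries n" by simp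
qed

lemma HS_trivialI: "cocycles n \<subseteq> coboundaries n \<Longrightarrow> HS n = {coboundaries n}"
  unfolding HS_def
  by (rule cosets_eq_singleton) (auto intro: zero_in_cocycles coboundaries_add coboundaries_uminus)


section \<open>Contraction and Cartan's formula\<close>

lemma sym_prod_cong:
  assumes "f \<in> CS n" "length xs = n" "mset ys = mset xs"
  shows "f (sym_prod xs) = f (sym_prod ys)"
  using CS_sym_multilinear[OF assms(1)] assms(2,3) unfolding sym_multilinear_def by blast

lemma sym_prod_scale:
  assumes "f \<in> CS (Suc n)" "length ys = n"
  shows "f (sym_prod (scale c x # ys)) = mscale c (f (sym_prod (x # ys)))"
  using CS_sym_multilinear[OF assms(1)] assms(2) unfolding sym_multilinear_def
  by (metis append_Nil list.size(3) plus_nat.add_0)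

lemma contraction_sym_multilinear:
  assumes "f \<in> CS (Suc n)"
  shows "sym_multilinear n (\<lambda>ys. f (sym_prod (x # ys)))"
proof -
  note f = CS_sym_multilinear[OF assms, unfolded sym_multilinear_def]
  show ?thesis
    unfolding sym_multilinear_def
  proof (intro conjI allI impI)
    fix us vs :: "'g list" and y z c
    assume n: "Suc (length us + length vs) = n"
    then have n': "Suc (length (x # us) + length vs) = Suc n" by simp
    show "f (sym_prod (x # us @ (y + z) # vs)) =
        f (sym_prod (x # us @ y # vs)) + f (sym_prod (x # us @ z # vs))"
      using f n' by (metis append_Cons)
    show "f (sym_prod (x # us @ scale c y # vs)) = mscale c (f (sym_prod (x # us @ y # vs)))"
      using f n' by (metis append_Cons)
  qed (use assms in \<open>auto intro: sym_prod_cong\<close>)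
qed

lemma sum_pairs_Suc:
  fixes K :: "nat \<Rightarrow> nat \<Rightarrow> 'm"
  shows "(\<Sum>(i, j) | i < j \<and> j < Suc n. K i j) =
    (\<Sum>j<n. K 0 (Suc j)) + (\<Sum>(i, j) | i < j \<and> j < n. K (Suc i) (Suc j))"
proof -
  let ?P = "\<lambda>n. {(i, j). i < j \<and> j < (n :: nat)}"
  let ?A = "(\<lambda>j. (0, Suc j)) ` {..<n}" and ?B = "map_prod Suc Suc ` ?P n"
  have "a \<in> ?A \<union> ?B" if a: "a \<in> ?P (Suc n)" for a
  proof -
    obtain i j' where ij: "a = (i, j')" "i < j'" "j' < Suc n" using a by auto
    then obtain j where "j' = Suc j" by (cases j') auto
    with ij have "a = (i, Suc j)" "i < Suc j" "j < n" by auto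
    then show ?thesis by (cases i) (auto intro!: image_eqI[of _ _ "(i - 1, j)"])
  qed
  then have P: "?P (Suc n) = ?A \<union> ?B" by auto
  have fin: "finite (?P n)"
    by (rule finite_subset[of _ "{..<n} \<times> {..<n}"]) auto
  have "(\<Sum>(i, j)\<in>?P (Suc n). K i j) = (\<Sum>(i, j)\<in>?A. K i j) + (\<Sum>(i, j)\<in>?B. K i j)"
    unfolding P using fin by (intro sum.union_disjoint) auto
  also have "(\<Sum>(i, j)\<in>?A. K i j) = (\<Sum>j<n. K 0 (Suc j))"
    by (subst sum.reindex) (auto simp: inj_on_def)
  also have "(\<Sum>(i, j)\<in>?B. K i j) = (\<Sum>(i, j)\<in>?P n. K (Suc i) (Suc j))"
    by (subst sum.reindex) (auto simp: inj_on_def case_prod_unfold)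
  finally show ?thesis .
qed

text \<open>
  The terms of the differential, sorted by the role of the first argument: it acts, it is
  bracketed with another argument, or (in the last two sums) it is passed on unchanged.
\<close>

lemma differential_at_Cons:
  "differential_at f (x # xs) =
    act x (f (sym_prod xs)) +
    (\<Sum>i<length xs. f (sym_prod (br x (xs ! i) # nths xs (- {i})))) +
    (\<Sum>i<length xs. act (xs ! i) (f (sym_prod (x # nths xs (- {i}))))) +
    (\<Sum>(i, j) | i < j \<and> j < length xs.
        f (sym_prod (br (xs ! i) (xs ! j) # x # nths xs (- {i, j}))))"
proof -
  have "nths (x # xs) (- {0}) = xs"
    and "nths (x # xs) (- {Suc i}) = x # nths xs (- {i})"
    and "nths (x # xs) (- {0, Suc j}) = nths xs (- {j})"
    and "nths (x # xs) (- {Suc i, Suc j}) = x # nths xs (- {i, j})" for i j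
    by (simp_all add: nths_Cons nths_all Compl_eq)
  then show ?thesis
    by (simp add: differential_at_def sum_pairs_Suc sum.lessThan_Suc_shift add_ac
        del: sum.lessThan_Suc)
qed

text \<open>
  The two copies of each term that has \<open>x\<close> as an untouched argument cancel because the
  characteristic is \<open>2\<close>; the sum on the right is the Lie derivative along \<open>x\<close>.
\<close>

lemma cartan_formula:
  assumes f: "f \<in> CS (Suc n)" and len: "length xs = Suc n"
    and g: "\<And>ys. length ys = n \<Longrightarrow> g (sym_prod ys) = f (sym_prod (x # ys))"
  shows "differential_at f (x # xs) + differential_at g xs =
    act x (f (sym_prod xs)) + (\<Sum>i<length xs. f (sym_prod (br x (xs ! i) # nths xs (- {i}))))"
proof -
  let ?A = "\<Sum>i<length xs. act (xs ! i) (f (sym_prod (x # nths xs (- {i}))))"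
  let ?B = "\<Sum>(i, j) | i < j \<and> j < length xs.
    f (sym_prod (br (xs ! i) (xs ! j) # x # nths xs (- {i, j})))"
  have "g (sym_prod (br (xs ! i) (xs ! j) # nths xs (- {i, j}))) =
      f (sym_prod (br (xs ! i) (xs ! j) # x # nths xs (- {i, j})))"
    if "i < j" "j < length xs" for i j
  proof -
    have l: "Suc (length (nths xs (- {i, j}))) = n"
      using that len by (simp add: length_nths_Compl)
    then show ?thesis by (subst g) (auto intro!: sym_prod_cong[OF f])
  qed
  then have "differential_at g xs = ?A + ?B"
    unfolding differential_at_def using len
    by (intro arg_cong2[where f = "(+)"] sum.cong) (auto simp: g length_nths_Compl)
  moreover have "L + S + ?A + ?B + (?A + ?B) = L + S" for L S
    using double_zero[of "?A + ?B"] by (simp add: add.assoc)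
  ultimately show ?thesis by (simp only: differential_at_Cons)
qed


section \<open>An ideal acting by the identity\<close>

text \<open>
  The scalar \<open>c\<close> with \<open>[x, y] = c x\<close> satisfies \<open>c m = [x, y] \<cdot> m = y \<cdot> m + y \<cdot> m = 0\<close>.
\<close>

lemma cochain_bracket_zero:
  assumes f: "f \<in> CS (Suc n)" and "length ys = n"
    and x: "\<And>m. act x m = m" and y: "br x y \<in> span {x}"
  shows "f (sym_prod (br x y # ys)) = 0"
proof -
  obtain c where c: "br x y = scale c x" using y by (auto simp: span_singleton)
  have "mscale c m = 0" for m
    using act_br[of x y m] by (simp add: c act_scale x double_zero)
  then show ?thesis using assms by (simp add: c sym_prod_scale)
qed

lemma cocycles_subset_coboundaries:
  assumes x: "\<And>m. act x m = m" and ideal: "\<And>y. br x y \<in> span {x}"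
  shows "cocycles n \<subseteq> coboundaries n"
proof
  fix f assume "f \<in> cocycles n"
  then have f: "f \<in> CS n" and d: "differential n f = 0" by (auto simp: cocycles_def)
  have d_at: "differential_at f xs = 0" if "length xs = Suc n" for xs
    using differential_sym_prod[OF f that] d by simp
  show "f \<in> coboundaries n"
  proof (cases n)
    case 0
    have "f = 0"
    proof (rule CS_eqI[OF f zero_in_CS])
      fix xs :: "'g list" assume "length xs = n"
      then show "f (sym_prod xs) = 0 (sym_prod xs)"
        using d_at[of "[x]"] 0 x by (simp add: differential_at_Cons)
    qed
    then show ?thesis using 0 by simp
  next
    case (Suc m)
    note f = f[unfolded Suc]
    obtain g where g: "g \<in> CS m"
      and g_prod: "\<And>ys. length ys = m \<Longrightarrow> g (sym_prod ys) = f (sym_prod (x # ys))"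
      using CS_ex1[OF contraction_sym_multilinear[OF f, of x]] by blast
    have "differential m g = f"
    proof (rule differential_eqI[OF g f])
      fix xs :: "'g list" assume len: "length xs = Suc m"
      have "(\<Sum>i<length xs. f (sym_prod (br x (xs ! i) # nths xs (- {i})))) = 0"
        using len x ideal
        by (intro sum.neutral ballI cochain_bracket_zero[OF f]) (auto simp: length_nths_Compl)
      then show "f (sym_prod xs) = differential_at g xs"
        using cartan_formula[OF f len g_prod] d_at[of "x # xs"] len Suc x by simp
    qed
    then show ?thesis using g Suc by auto
  qed
qed

end

theorem theorem4p1:
  fixes scale :: "'f::field \<Rightarrow> 'g::ab_group_add \<Rightarrow> 'g"
    and br :: "'g \<Rightarrow> 'g \<Rightarrow> 'g"
    and mscale :: "'f \<Rightarrow> 'm::ab_group_add \<Rightarrow> 'm"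
    and act :: "'g \<Rightarrow> 'm \<Rightarrow> 'm"
    and h :: "'g set"
    and n :: nat
  assumes "commutative_lie_algebra scale br"
    and "commutative_lie_algebra.lie_ideal scale br h"
    and "vector_space.dim scale h = 1"
    and "commutative_lie_module scale br mscale act"
    and "vector_space.dim mscale (UNIV :: 'm set) = 1"
    and "\<exists>x. module.span scale {x} = h \<and> (\<forall>v. act x v = v)"
  shows "commutative_lie_module.HS scale br mscale act n =
    {commutative_lie_module.coboundaries scale br mscale act n}"
proof -
  interpret commutative_lie_module scale br mscale act by fact
  obtain x where h: "span {x} = h" and x: "\<And>v. act x v = v" using assms(6) by blast
  have "br y x \<in> h" for y
    using assms(2) h span_base[of x "{x}"] by (auto simp: lie_ideal_def)
  then have "br x y \<in> span {x}" for y
    unfolding h by (simp add: br_commute[of x])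
  then show ?thesis
    by (intro HS_trivialI cocycles_subset_coboundaries[OF x])
qed

end
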